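(* Let $\{x^t\},\{y^t\}$ be the iterates of the private gossip algorithm with binary oracle with positive stepsizes $\{\lambda^t\}_{t\ge0}$. For all $k\ge1$ we have $$\min_{t=0,1,\dots,k}\mathbb{E}[L^t]\ \le\ \sum_{t=0}^k\frac{\lambda^t}{\alpha^k}\,\mathbb{E}[L^t]\ \le\ U^k:=\frac{D(y^* )-D(y^0)}{\alpha^k}+\frac{\beta^k}{\alpha^k}.$$ Moreover: (i) If we set $\lambda^t=\lambda^0>0$ for all $t$, then $U^k=\frac{D(y^* )-D(y^0)}{\lambda^0(k+1)}+\lambda^0$. (ii) Let $R$ be any constant such that $R\ge D(y^* )-D(y^0)$. If we fix $k\ge1$, then the choice of stepsizes $\{\lambda^0,\dots,\lambda^k\}$ which minimizes $U^k$ corresponds to the constant stepsize rule $\lambda^t=\sqrt{\frac{R}{k+1}}$ for all $t=0,1,\dots,k$, and $U^k=2\sqrt{\frac{R}{k+1}}$. (iii) If we set $\lambda^t=a/\sqrt{t+1}$ for all $t=0,1,\dots,k$, then $$U^k\le\frac{D(y^* )-D(y^0)+a^2\left(\log(k+3/2)+\log 2\right)}{2a\left(\sqrt{k+2}-1\right)}=O\left(\frac{\log k}{\sqrt k}\right).$$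
   Context: $\mathcal G=(\mathcal V,\mathcal E)$ is an undirected connected graph with $\mathcal V=\{1,\dots,n\}$, $|\mathcal E|=m$. $\mathbf A\in\mathbb{R}^{m\times n}$ is the incidence matrix: row $e=(i,j)$ has $\mathbf A_{ei}=1$, $\mathbf A_{ej}=-1$ and all other entries $0$; $f_e\in\mathbb{R}^m$ is the unit basis vector indexed by $e$. $c\in\mathbb{R}^n$ is the vector of initial (private) values, $D(y)=-(\mathbf A c)^\top y-\frac12\|\mathbf A^\top y\|^2$ with $\|\cdot\|$ the Euclidean norm, and $y^*$ is a maximizer of $D$ over $\mathbb{R}^m$. Private gossip with binary oracle: given a sequence of positive stepsizes $\{\lambda^t\}_{t\ge0}$, set $y^0=0\in\mathbb{R}^m$, $x^0=c$. In each iteration $t=0,1,\dots$ choose $e=(i,j)\in\mathcal E$ uniformly at random. If $x^t_i<x^t_j$ set $y^{t+1}=y^t+\lambda^tf_e$, $x^{t+1}_i=x^t_i+\lambda^t$, $x^{t+1}_j=x^t_j-\lambda^t$; if $x^t_i\ge x^t_j$ set $y^{t+1}=y^t-\lambda^tf_e$, $x^{t+1}_i=x^t_i-\lambda^t$, $x^{t+1}_j=x^t_j+\lambda^t$; and $x^{t+1}_l=x^t_l$ for $l\notin\{i,j\}$ (so $x^t=c+\mathbf A^\top y^t$). Notation: $\alpha^k=\sum_{t=0}^k\lambda^t$, $\beta^k=\sum_{t=0}^k(\lambda^t)^2$ (the superscripts of $\alpha,\beta,\lambda,L,U$ are indices), and $L^t=\frac1m\sum_{e=(i,j)\in\mathcal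 E}|x^t_i-x^t_j|$. In (iii), $a>0$ is a constant.
   Formalization: In (ii), for R larger than D(y* )−D(y⁰) the claim about U^k is false; what is minimized, with value 2√(R/(k+1)), is the upper bound R/α^k+β^k/α^k ≥ U^k, which is U^k when R=D(y* )−D(y⁰). R>0 is assumed, as R=0 would give zero stepsizes. *)

theory Defs
  imports "HOL-Probability.Probability" "HOL-Library.Landau_Symbols"
begin

text \<open>
  The vertex set is the whole type \<open>'n\<close>, so that \<open>n = CARD('n)\<close>.
\<close>

definition undirected_graph :: "'n set set \<Rightarrow> bool" where
  "undirected_graph E \<longleftrightarrow> (\<forall>e\<in>E. card e = 2)"

definition connected_graph :: "'n set set \<Rightarrow> bool" where
  "connected_graph E \<longleftrightarrow> (\<forall>u v. (u, v) \<in> {(i, j). {i, j} \<in> E}\<^sup>*)"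

text \<open>
  The edges are enumerated by the finite type \<open>'e\<close>, so that \<open>m = CARD('e) = card E\<close>; the pair
  \<open>ends e = (i, j)\<close> fixes the order in which the endpoints of an edge are written.
  As types are inhabited, such an \<open>E\<close> is nonempty.
\<close>

definition edge_enumeration :: "'n set set \<Rightarrow> ('e \<Rightarrow> 'n \<times> 'n) \<Rightarrow> bool" where
  "edge_enumeration E ends \<longleftrightarrow> bij_betw (\<lambda>e. {fst (ends e), snd (ends e)}) UNIV E"

definition incidence_matrix :: "('e::finite \<Rightarrow> 'n::finite \<times> 'n) \<Rightarrow> real^'n^'e" where
  "incidence_matrix ends =
     (\<chi> e v. if v = fst (ends e) then 1 else if v = snd (ends e) then - 1 else 0)"

definition dual_objective :: "real^'n^'e \<Rightarrow> real^'n \<Rightarrow> real^'e \<Rightarrow> real" where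
  "dual_objective A c y = - ((A *v c) \<bullet> y) - 1 / 2 * (norm (transpose A *v y))\<^sup>2"

definition gossip_step ::
    "('e::finite \<Rightarrow> 'n::finite \<times> 'n) \<Rightarrow> real \<Rightarrow> 'e \<Rightarrow> (real^'e) \<times> (real^'n) \<Rightarrow> (real^'e) \<times> (real^'n)"
  where
  "gossip_step ends s e yx =
     (let y = fst yx; x = snd yx; i = fst (ends e); j = snd (ends e) in
      if x $ i < x $ j
      then (y + s *\<^sub>R axis e 1,
            \<chi> l. if l = i then x $ i + s else if l = j then x $ j - s else x $ l)
      else (y - s *\<^sub>R axis e 1,
            \<chi> l. if l = i then x $ i - s else if l = j then x $ j + s else x $ l))"

text \<open>The pair \<open>(y\<^sup>t, x\<^sup>t)\<close> when edge \<open>es t\<close> is the one selected in iteration \<open>t\<close>.\<close>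

primrec gossip ::
    "('e::finite \<Rightarrow> 'n::finite \<times> 'n) \<Rightarrow> (nat \<Rightarrow> real) \<Rightarrow> real^'n \<Rightarrow> (nat \<Rightarrow> 'e) \<Rightarrow> nat
      \<Rightarrow> (real^'e) \<times> (real^'n)" where
  "gossip ends lam c es 0 = (0, c)"
| "gossip ends lam c es (Suc t) = gossip_step ends (lam t) (es t) (gossip ends lam c es t)"

definition gossip_x ::
    "('e::finite \<Rightarrow> 'n::finite \<times> 'n) \<Rightarrow> (nat \<Rightarrow> real) \<Rightarrow> real^'n \<Rightarrow> (nat \<Rightarrow> 'e) \<Rightarrow> nat \<Rightarrow> real^'n"
  where "gossip_x ends lam c es t = snd (gossip ends lam c es t)"

definition edge_loss :: "('e::finite \<Rightarrow> 'n::finite \<times> 'n) \<Rightarrow> real^'n \<Rightarrow> real" where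
  "edge_loss ends x =
     1 / real CARD('e) * (\<Sum>e\<in>UNIV. \<bar>x $ fst (ends e) - x $ snd (ends e)\<bar>)"

definition step_sum :: "(nat \<Rightarrow> real) \<Rightarrow> nat \<Rightarrow> real" where
  "step_sum lam k = (\<Sum>t=0..k. lam t)"

definition step_sq_sum :: "(nat \<Rightarrow> real) \<Rightarrow> nat \<Rightarrow> real" where
  "step_sq_sum lam k = (\<Sum>t=0..k. (lam t)\<^sup>2)"

text \<open>
  \<open>U\<^sup>k\<close> is the case where the gap \<open>d\<close> is \<open>D(y*) - D(y\<^sup>0)\<close>, with \<open>y\<^sup>0 = 0\<close>. Keeping \<open>d\<close> as a parameter also
  covers the bound in which the unknown gap is replaced by an upper estimate \<open>R\<close> of it.
\<close>

definition gossip_bound :: "real \<Rightarrow> (nat \<Rightarrow> real) \<Rightarrow> nat \<Rightarrow> real" where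
  "gossip_bound d lam k = d / step_sum lam k + step_sq_sum lam k / step_sum lam k"

end

theory Submission
  imports Defs "HOL-Real_Asymp.Real_Asymp"
begin

text \<open>
  The gossip algorithm is randomized coordinate ascent on the dual function \<open>D\<close>. Along every run
  the primal iterate is \<open>x = c + A\<^sup>T y\<close>, so the partial derivative of \<open>D\<close> in direction \<open>f\<^sub>e\<close> is
  \<open>-(x\<^sub>i - x\<^sub>j)\<close>, and the binary oracle moves \<open>y\<^sub>e\<close> by \<open>\<lambda>\<close> in the direction of ascent. As \<open>D\<close> is
  quadratic with curvature \<open>\<parallel>A\<^sup>T f\<^sub>e\<parallel>\<^sup>2 = 2\<close>, one step raises \<open>D\<close> by \<^emph>\<open>exactly\<close>
  \<open>\<lambda>\<bar>x\<^sub>i - x\<^sub>j\<bar> - \<lambda>\<^sup>2\<close> (\<open>dual_gossip_step\<close>). Summing along a run telescopes to a pathwise identity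
  (\<open>dual_telescope\<close>), and bounding the final value of \<open>D\<close> by its maximum gives
  \<open>\<Sum> \<lambda>\<^sup>t \<bar>x\<^sub>i - x\<^sub>j\<bar> \<le> D(y\<^sup>*) - D(0) + \<beta>\<close>, the endpoints \<open>i, j\<close> being those of the edge drawn at
  time \<open>t\<close>.

  Probability enters only afterwards. The state \<open>x\<^sup>t\<close> is a function of the edges drawn before time
  \<open>t\<close>, hence independent of the uniform edge drawn at time \<open>t\<close>; the expectation of
  \<open>\<bar>x\<^sub>i - x\<^sub>j\<bar>\<close> at that edge is therefore the expected average over all edges, which is
  \<open>\<bbbE>[L\<^sup>t]\<close> (\<open>expectation_fresh_uniform\<close>). Division by \<open>\<alpha>\<close> gives the general bound.

  The stepsize rules are calculus. With an upper estimate \<open>R\<close> in place of the gap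
  \<open>D(y\<^sup>*) - D(0)\<close>, and \<open>r = sqrt (R / (k+1))\<close>, one has
  \<open>U = 2 r + (\<Sum> (\<lambda>\<^sup>t - r)\<^sup>2) / \<alpha>\<close>, which shows at once that the constant rule \<open>r\<close> is the unique
  minimizer and that its value is \<open>2 r\<close>. For \<open>\<lambda>\<^sup>t = a / sqrt (t+1)\<close> the sums \<open>\<alpha>\<close> and \<open>\<beta>\<close> are
  compared with integrals of \<open>1/sqrt x\<close> and \<open>1/x\<close>, where the midpoint rule, which underestimates
  the integral of the convex function \<open>1/x\<close>, produces the constants \<open>3/2\<close> and \<open>ln 2\<close>.
\<close>

section \<open>Dual ascent along a run\<close>

lemma transpose_mult_axis: "transpose A *v axis e 1 = A $ e"
  for A :: "real^'n::finite^'e::finite"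
  by (simp add: matrix_vector_mult_basis column_def transpose_def vec_eq_iff
      del: transpose_matrix_vector)

lemma dual_objective_coordinate_step:
  fixes A :: "real^'n::finite^'e::finite"
  shows "dual_objective A c (y + r *\<^sub>R axis e 1) =
    dual_objective A c y - r * (A $ e \<bullet> (c + transpose A *v y)) - r\<^sup>2 / 2 * (norm (A $ e))\<^sup>2"
proof -
  have lin: "transpose A *v (y + r *\<^sub>R axis e 1) = transpose A *v y + r *\<^sub>R (A $ e)"
    by (simp add: matrix_vector_right_distrib matrix_vector_mult_scaleR transpose_mult_axis
        del: transpose_matrix_vector)
  have "(A *v c) \<bullet> axis e 1 = A $ e \<bullet> c"
    by (simp add: inner_axis matrix_vector_mul_component)
  then show ?thesis
    unfolding dual_objective_def lin power2_norm_eq_inner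
    by (simp add: inner_simps inner_commute algebra_simps power2_eq_square)
qed

lemma incidence_matrix_row:
  assumes "fst (ends e) \<noteq> snd (ends e)"
  shows "incidence_matrix ends $ e = axis (fst (ends e)) 1 - axis (snd (ends e)) 1"
  using assms by (auto simp: incidence_matrix_def axis_def vec_eq_iff)

lemma incidence_matrix_row_inner:
  assumes "fst (ends e) \<noteq> snd (ends e)"
  shows "incidence_matrix ends $ e \<bullet> x = x $ fst (ends e) - x $ snd (ends e)"
  using assms by (simp add: incidence_matrix_row inner_diff_left inner_axis')

lemma incidence_matrix_row_norm:
  assumes "fst (ends e) \<noteq> snd (ends e)"
  shows "(norm (incidence_matrix ends $ e))\<^sup>2 = 2"
  unfolding power2_norm_eq_inner incidence_matrix_row_inner[of ends, OF assms]
  using assms by (simp add: incidence_matrix_row axis_def)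

lemma gossip_step_eq:
  assumes "fst (ends e) \<noteq> snd (ends e)"
  shows "gossip_step ends s e (y, x) =
    (let r = if x $ fst (ends e) < x $ snd (ends e) then s else - s
     in (y + r *\<^sub>R axis e 1, x + r *\<^sub>R (incidence_matrix ends $ e)))"
  using assms
  by (auto simp: gossip_step_def Let_def incidence_matrix_row vec_eq_iff axis_def)

lemma gossip_primal_dual:
  assumes "\<And>e. fst (ends e) \<noteq> snd (ends e)"
  shows "snd (gossip ends lam c es t) =
    c + transpose (incidence_matrix ends) *v fst (gossip ends lam c es t)"
proof (induction t)
  case (Suc t)
  obtain y x where "gossip ends lam c es t = (y, x)" by fastforce
  with Suc show ?case
    by (simp add: gossip_step_eq[of ends, OF assms] Let_def matrix_vector_right_distrib
        matrix_vector_mult_scaleR transpose_mult_axis del: transpose_matrix_vector)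
qed simp

text \<open>
  The increase is an equality because \<open>D\<close> is quadratic, and the oracle's sign turns the linear term
  into an absolute value; in the tie case \<open>x\<^sub>i = x\<^sub>j\<close> that term vanishes whichever sign is used.
\<close>

lemma dual_gossip_step:
  fixes ends :: "'e::finite \<Rightarrow> 'n::finite \<times> 'n" and c :: "real^'n"
  assumes "\<And>e. fst (ends e) \<noteq> snd (ends e)"
  defines "D \<equiv> dual_objective (incidence_matrix ends) c"
  shows "D (fst (gossip ends lam c es (Suc t))) = D (fst (gossip ends lam c es t))
    + lam t * \<bar>gossip_x ends lam c es t $ fst (ends (es t))
               - gossip_x ends lam c es t $ snd (ends (es t))\<bar>
    - (lam t)\<^sup>2"
proof -
  obtain y x where yx: "gossip ends lam c es t = (y, x)" by fastforce
  have x: "c + transpose (incidence_matrix ends) *v y = x"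
    using gossip_primal_dual[of ends lam c es t, OF assms(1)] yx by simp
  show ?thesis
    by (simp add: D_def yx gossip_x_def gossip_step_eq[of ends, OF assms(1)] Let_def
        dual_objective_coordinate_step x incidence_matrix_row_inner[of ends, OF assms(1)]
        incidence_matrix_row_norm[of ends, OF assms(1)] abs_if algebra_simps
        del: scaleR_minus_left transpose_matrix_vector)
qed

lemma dual_telescope:
  fixes ends :: "'e::finite \<Rightarrow> 'n::finite \<times> 'n" and c :: "real^'n"
  assumes "\<And>e. fst (ends e) \<noteq> snd (ends e)"
  defines "D \<equiv> dual_objective (incidence_matrix ends) c"
  shows "(\<Sum>t=0..k. lam t * \<bar>gossip_x ends lam c es t $ fst (ends (es t))
                          - gossip_x ends lam c es t $ snd (ends (es t))\<bar>)
    = D (fst (gossip ends lam c es (Suc k))) - D 0 + step_sq_sum lam k"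
proof (induction k)
  case 0
  show ?case
    using dual_gossip_step[of ends c lam es 0, OF assms(1)]
    by (simp add: D_def step_sq_sum_def del: gossip.simps(2))
next
  case (Suc k)
  then show ?case
    using dual_gossip_step[of ends c lam es "Suc k", OF assms(1)]
    by (simp add: D_def step_sq_sum_def del: gossip.simps(2))
qed

section \<open>Averaging over the edge drawn next\<close>

lemma gossip_cong:
  assumes "\<And>s. s < t \<Longrightarrow> es s = es' s"
  shows "gossip ends lam c es t = gossip ends lam c es' t"
  using assms by (induction t) auto

text \<open>
  Finitely many draws from a finite type leave only finitely many possible histories, so the
  variable is measurable and bounded by its largest absolute value on a history.
\<close>

lemma integrable_finite_history:
  fixes edge :: "nat \<Rightarrow> 'w \<Rightarrow> 'e::finite" and h :: "(nat \<Rightarrow> 'e) \<Rightarrow> real"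
  assumes "prob_space M"
    and rv: "\<And>t. edge t \<in> measurable M (count_space UNIV)"
    and hist: "\<And>es es'. (\<And>s. s < t \<Longrightarrow> es s = es' s) \<Longrightarrow> h es = h es'"
  shows "integrable M (\<lambda>w. h (\<lambda>s. edge s w))"
proof -
  interpret prob_space M by fact
  let ?P = "\<Pi>\<^sub>E s\<in>{..<t}. (UNIV :: 'e set)"
  have P: "Pi\<^sub>M {..<t} (\<lambda>_. count_space UNIV) = count_space ?P"
    by (rule count_space_PiM_finite) auto
  have "(\<lambda>w. restrict (\<lambda>s. edge s w) {..<t}) \<in> measurable M (count_space ?P)"
    unfolding P[symmetric] by (rule measurable_restrict) (rule rv)
  then have "(\<lambda>w. h (restrict (\<lambda>s. edge s w) {..<t})) \<in> borel_measurable M"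
    by (rule measurable_compose) simp
  moreover have restr: "h (restrict es {..<t}) = h es" for es
    by (rule hist) simp
  ultimately have meas: "(\<lambda>w. h (\<lambda>s. edge s w)) \<in> borel_measurable M" by simp
  have fin: "finite ((\<lambda>es. \<bar>h es\<bar>) ` ?P)" by (intro finite_imageI finite_PiE) auto
  have "norm (h (\<lambda>s. edge s w)) \<le> Max ((\<lambda>es. \<bar>h es\<bar>) ` ?P)" for w
    unfolding restr[of "\<lambda>s. edge s w", symmetric] real_norm_def
    by (intro Max_ge fin imageI) (simp add: restrict_PiE_iff del: restrict_apply)
  then show ?thesis
    by (intro integrable_const_bound[OF _ meas]) auto
qed

text \<open>
  Splitting according to the value \<open>e\<close> of the fresh draw writes the integrand as
  \<open>\<Sum>e. indicator {edge t = e} * h e\<close>; each factor \<open>h e\<close> depends only on the past, so each expectation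
  factorizes and the indicator contributes \<open>1 / CARD('e)\<close>.
\<close>

lemma expectation_fresh_uniform:
  fixes edge :: "nat \<Rightarrow> 'w \<Rightarrow> 'e::finite" and h :: "'e \<Rightarrow> (nat \<Rightarrow> 'e) \<Rightarrow> real"
  assumes "prob_space M"
    and indep: "prob_space.indep_vars M (\<lambda>_. count_space UNIV) edge UNIV"
    and unif: "distr M (count_space UNIV) (edge t) = uniform_count_measure UNIV"
    and hist: "\<And>e es es'. (\<And>s. s < t \<Longrightarrow> es s = es' s) \<Longrightarrow> h e es = h e es'"
  shows "integrable M (\<lambda>w. h (edge t w) (\<lambda>s. edge s w))" (is ?int)
    and "prob_space.expectation M (\<lambda>w. h (edge t w) (\<lambda>s. edge s w)) =
      prob_space.expectation M (\<lambda>w. 1 / real CARD('e) * (\<Sum>e\<in>UNIV. h e (\<lambda>s. edge s w)))" (is ?eq)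
proof -
  interpret prob_space M by fact
  have rv: "edge s \<in> measurable M (count_space UNIV)" for s
    using indep by (simp add: indep_vars_def)
  have inth: "integrable M (\<lambda>w. h e (\<lambda>s. edge s w))" for e
    by (rule integrable_finite_history[OF assms(1) rv hist])
  show ?int
    by (rule integrable_finite_history[where t = "Suc t"])
      (auto simp: assms(1) rv intro: hist arg_cong2[where f = h])
  have restr: "h e (restrict es {..<t}) = h e es" for e es
    by (rule hist) simp
  let ?I = "\<lambda>e w. indicator {e} (edge t w) :: real"
  have prob: "expectation (?I e) = 1 / real CARD('e)" for e
  proof -
    have "expectation (?I e) = measure (distr M (count_space UNIV) (edge t)) {e}"
      using integral_distr[OF rv, of "indicator {e} :: 'e \<Rightarrow> real" t] by simp
    also have "\<dots> = 1 / real CARD('e)"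
      by (simp add: unif measure_uniform_count_measure)
    finally show ?thesis .
  qed
  have fact: "integrable M (\<lambda>w. ?I e w * h e (\<lambda>s. edge s w)) \<and>
      expectation (\<lambda>w. ?I e w * h e (\<lambda>s. edge s w)) =
      1 / real CARD('e) * expectation (\<lambda>w. h e (\<lambda>s. edge s w))" for e
  proof -
    have P: "Pi\<^sub>M J (\<lambda>_. count_space (UNIV :: 'e set)) = count_space (\<Pi>\<^sub>E s\<in>J. UNIV)"
      if "finite J" for J :: "nat set"
      using that by (intro count_space_PiM_finite) auto
    have "indep_var (Pi\<^sub>M {t} (\<lambda>_. count_space UNIV)) (\<lambda>w. restrict (\<lambda>s. edge s w) {t})
        (Pi\<^sub>M {..<t} (\<lambda>_. count_space UNIV)) (\<lambda>w. restrict (\<lambda>s. edge s w) {..<t})"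
      by (rule indep_var_restrict[OF indep]) auto
    then have "indep_var borel ((\<lambda>es. indicator {e} (es t) :: real) \<circ> (\<lambda>w. restrict (\<lambda>s. edge s w) {t}))
        borel (h e \<circ> (\<lambda>w. restrict (\<lambda>s. edge s w) {..<t}))"
      by (rule indep_var_compose) (simp_all add: P)
    then have iv: "indep_var borel (?I e) borel (\<lambda>w. h e (\<lambda>s. edge s w))"
      by (simp add: comp_def restr)
    have intI: "integrable M (?I e)"
      by (intro integrable_const_bound[where B = 1] AE_I2 measurable_compose[OF rv])
         (auto simp: indicator_def)
    show ?thesis
      using indep_var_lebesgue_integral[OF iv intI inth] indep_var_integrable[OF iv intI inth]
      by (simp add: prob)
  qed
  have "h (edge t w) es = (\<Sum>e\<in>UNIV. ?I e w * h e es)" for w es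
    by (simp add: indicator_def if_distrib[of "\<lambda>x. x * _"] cong: if_cong)
  then have "expectation (\<lambda>w. h (edge t w) (\<lambda>s. edge s w)) =
      expectation (\<lambda>w. \<Sum>e\<in>UNIV. ?I e w * h e (\<lambda>s. edge s w))" by simp
  also have "\<dots> = (\<Sum>e\<in>UNIV. expectation (\<lambda>w. ?I e w * h e (\<lambda>s. edge s w)))"
    using fact by (intro Bochner_Integration.integral_sum) auto
  also have "\<dots> = 1 / real CARD('e) * (\<Sum>e\<in>UNIV. expectation (\<lambda>w. h e (\<lambda>s. edge s w)))"
    using fact by (simp add: sum_distrib_left)
  also have "\<dots> = expectation (\<lambda>w. 1 / real CARD('e) * (\<Sum>e\<in>UNIV. h e (\<lambda>s. edge s w)))"
    using inth by (simp add: Bochner_Integration.integral_sum)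
  finally show ?eq .
qed

text \<open>
  In the telescoped identity the final dual value exceeds \<open>D(0)\<close> by at most \<open>d\<close> on every run; taking
  expectations then replaces the drawn edge by the average over all edges.
\<close>

lemma weighted_expected_loss_le:
  fixes ends :: "'e::finite \<Rightarrow> 'n::finite \<times> 'n" and edge :: "nat \<Rightarrow> 'w \<Rightarrow> 'e"
  assumes loopfree: "\<And>e. fst (ends e) \<noteq> snd (ends e)"
    and max: "\<And>y. dual_objective (incidence_matrix ends) c y \<le> d + dual_objective (incidence_matrix ends) c 0"
    and "prob_space M"
    and indep: "prob_space.indep_vars M (\<lambda>_. count_space UNIV) edge UNIV"
    and unif: "\<And>t. distr M (count_space UNIV) (edge t) = uniform_count_measure UNIV"
  shows "(\<Sum>t=0..k. lam t * prob_space.expectation M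
            (\<lambda>w. edge_loss ends (gossip_x ends lam c (\<lambda>s. edge s w) t)))
    \<le> d + step_sq_sum lam k"
proof -
  interpret prob_space M by fact
  define h where "h t e es = \<bar>gossip_x ends lam c es t $ fst (ends e)
      - gossip_x ends lam c es t $ snd (ends e)\<bar>" for t e es
  have hist: "h t e es = h t e es'" if "\<And>s. s < t \<Longrightarrow> es s = es' s" for t e es es'
    using gossip_cong[of t es es' ends lam c] that by (simp add: h_def gossip_x_def)
  note fresh = expectation_fresh_uniform[where h = "h _", OF assms(3) indep unif hist]
  have "(\<Sum>t=0..k. lam t * expectation (\<lambda>w. edge_loss ends (gossip_x ends lam c (\<lambda>s. edge s w) t)))
      = (\<Sum>t=0..k. lam t * expectation (\<lambda>w. h t (edge t w) (\<lambda>s. edge s w)))"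
    by (subst fresh(2)) (simp_all add: edge_loss_def h_def)
  also have "\<dots> = expectation (\<lambda>w. \<Sum>t=0..k. lam t * h t (edge t w) (\<lambda>s. edge s w))"
    using fresh(1) by (subst Bochner_Integration.integral_sum) auto
  also have "\<dots> \<le> d + step_sq_sum lam k"
  proof (rule integral_le_const)
    show "integrable M (\<lambda>w. \<Sum>t=0..k. lam t * h t (edge t w) (\<lambda>s. edge s w))"
      using fresh(1) by auto
    show "AE w in M. (\<Sum>t=0..k. lam t * h t (edge t w) (\<lambda>s. edge s w)) \<le> d + step_sq_sum lam k"
    proof (rule AE_I2)
      fix w
      show "(\<Sum>t=0..k. lam t * h t (edge t w) (\<lambda>s. edge s w)) \<le> d + step_sq_sum lam k"
        using dual_telescope[of ends lam c "\<lambda>s. edge s w" k, OF loopfree]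
          max[of "fst (gossip ends lam c (\<lambda>s. edge s w) (Suc k))"]
        by (simp add: h_def)
    qed
  qed
  finally show ?thesis .
qed

section \<open>Stepsize rules\<close>

lemma step_sum_pos:
  assumes "\<And>t. t \<le> k \<Longrightarrow> 0 < l t"
  shows "0 < step_sum l k"
  unfolding step_sum_def using assms by (intro sum_pos) auto

lemma Min_le_weighted_average:
  fixes f :: "nat \<Rightarrow> real"
  assumes "\<And>t. t \<le> k \<Longrightarrow> 0 < l t"
  shows "Min (f ` {0..k}) \<le> (\<Sum>t=0..k. l t / step_sum l k * f t)"
proof -
  have pos: "0 < step_sum l k" using assms by (rule step_sum_pos)
  have "Min (f ` {0..k}) = (\<Sum>t=0..k. l t / step_sum l k) * Min (f ` {0..k})"
    using pos by (simp add: sum_divide_distrib[symmetric] step_sum_def[symmetric])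
  also have "\<dots> = (\<Sum>t=0..k. l t / step_sum l k * Min (f ` {0..k}))"
    by (simp add: sum_distrib_right)
  also have "\<dots> \<le> (\<Sum>t=0..k. l t / step_sum l k * f t)"
    using pos assms by (intro sum_mono mult_left_mono) (auto intro: Min_le divide_nonneg_pos less_imp_le)
  finally show ?thesis .
qed

text \<open>
  Completing the square in \<open>R + \<beta> - 2 r \<alpha>\<close> spreads \<open>R = (k+1) r\<^sup>2\<close> over the \<open>k+1\<close> steps, which is where
  the optimal stepsize comes from.
\<close>

lemma gossip_bound_excess:
  assumes "\<And>t. t \<le> k \<Longrightarrow> 0 < l t" and R: "R = (real k + 1) * r\<^sup>2"
  shows "gossip_bound R l k = 2 * r + (\<Sum>t=0..k. (l t - r)\<^sup>2) / step_sum l k"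
proof -
  have pos: "0 < step_sum l k" using assms(1) by (rule step_sum_pos)
  have "(\<Sum>t=0..k. (l t - r)\<^sup>2) = R + step_sq_sum l k - 2 * r * step_sum l k"
    by (simp add: power2_diff sum.distrib sum_subtractf R step_sq_sum_def step_sum_def
        sum_distrib_left mult.assoc mult.commute mult.left_commute)
  then show ?thesis using pos by (simp add: gossip_bound_def field_simps)
qed

lemma gossip_bound_arg_min_iff:
  assumes "0 < r" and R: "R = (real k + 1) * r\<^sup>2"
  shows "is_arg_min (\<lambda>l. gossip_bound R l k) (\<lambda>l. \<forall>t\<le>k. 0 < l t) l \<longleftrightarrow> (\<forall>t\<le>k. l t = r)"
proof
  assume l: "is_arg_min (\<lambda>l. gossip_bound R l k) (\<lambda>l. \<forall>t\<le>k. 0 < l t) l"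
  then have pos: "\<And>t. t \<le> k \<Longrightarrow> 0 < l t"
    and "\<not> gossip_bound R (\<lambda>_. r) k < gossip_bound R l k"
    using \<open>0 < r\<close> by (auto simp: is_arg_min_def)
  then have "(\<Sum>t=0..k. (l t - r)\<^sup>2) / step_sum l k \<le> 0"
    using gossip_bound_excess[of k l, OF pos R] gossip_bound_excess[of k "\<lambda>_. r", OF _ R] \<open>0 < r\<close>
    by simp
  then have "(\<Sum>t=0..k. (l t - r)\<^sup>2) \<le> 0"
    using step_sum_pos[of k l, OF pos] by (simp add: divide_le_0_iff)
  then have "(\<Sum>t=0..k. (l t - r)\<^sup>2) = 0" by (intro antisym sum_nonneg) auto
  then show "\<forall>t\<le>k. l t = r" by (subst (asm) sum_nonneg_eq_0_iff) auto
next
  assume l: "\<forall>t\<le>k. l t = r"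
  have "gossip_bound R l k \<le> gossip_bound R l' k" if l': "\<forall>t\<le>k. 0 < l' t" for l'
  proof -
    have "0 \<le> (\<Sum>t=0..k. (l' t - r)\<^sup>2) / step_sum l' k"
      using step_sum_pos[of k l'] l' by (intro divide_nonneg_pos sum_nonneg) auto
    then show ?thesis
      using gossip_bound_excess[of k l, OF _ R] gossip_bound_excess[of k l', OF _ R] l l' \<open>0 < r\<close>
      by simp
  qed
  then show "is_arg_min (\<lambda>l. gossip_bound R l k) (\<lambda>l. \<forall>t\<le>k. 0 < l t) l"
    using l \<open>0 < r\<close> by (auto simp: is_arg_min_linorder)
qed

lemma gossip_bound_constant:
  assumes "\<And>t. l t = s" and "0 < s"
  shows "gossip_bound d l k = d / (s * (real k + 1)) + s"
proof -
  have "step_sum l k = s * (real k + 1)" "step_sq_sum l k = s * (real k + 1) * s"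
    by (simp_all add: step_sum_def step_sq_sum_def assms(1) power2_eq_square algebra_simps)
  moreover have "s * (real k + 1) \<noteq> 0" using assms(2) by auto
  ultimately show ?thesis unfolding gossip_bound_def by simp
qed

lemma sum_inverse_sqrt_ge: "2 * (sqrt (real k + 2) - 1) \<le> (\<Sum>t=0..k. 1 / sqrt (real t + 1))"
proof -
  \<comment> \<open>The decreasing function \<open>1/sqrt\<close> is largest at the left end of \<open>[x, x + 1]\<close>, and the left-hand
    side is its integral over that interval.\<close>
  have step: "2 * (sqrt (x + 1) - sqrt x) \<le> 1 / sqrt x" if "0 < x" for x :: real
  proof -
    have "2 * sqrt (x + 1) * sqrt x \<le> 2 * x + 1"
    proof -
      have "0 \<le> (sqrt (x + 1) - sqrt x)\<^sup>2" by simp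
      then show ?thesis using that by (simp add: power2_diff)
    qed
    moreover have "sqrt x * sqrt x = x" using that by simp
    ultimately have "2 * (sqrt (x + 1) - sqrt x) * sqrt x \<le> 1"
      by (simp add: left_diff_distrib right_diff_distrib mult.assoc del: real_sqrt_mult_self)
    then show ?thesis using that by (simp add: pos_le_divide_eq)
  qed
  show ?thesis
  proof (induction k)
    case 0
    show ?case using step[of 1] by simp
  next
    case (Suc k)
    then show ?case using step[of "real k + 2"] by (simp add: add.commute)
  qed
qed

lemma harmonic_sum_le: "(\<Sum>t=0..k. 1 / (real t + 1)) \<le> ln (real k + 3 / 2) + ln 2"
proof -
  \<comment> \<open>The midpoint rule for the convex function \<open>1/x\<close> on \<open>[t + 1/2, t + 3/2]\<close>.\<close>
  have step: "1 / (real t + 1) \<le> ln (real t + 3 / 2) - ln (real t + 1 / 2)" for t :: nat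
    using ln_inverse_approx_ge[of "real t + 1 / 2" "real t + 3 / 2"] by (simp add: field_simps)
  show ?thesis
  proof (induction k)
    case 0
    show ?case using step[of 0] by (simp add: ln_div)
  next
    case (Suc k)
    then show ?case using step[of "Suc k"] by (simp add: add.commute)
  qed
qed

lemma gossip_bound_inverse_sqrt:
  assumes "0 \<le> d" "0 < a" "\<And>t. t \<le> k \<Longrightarrow> l t = a / sqrt (real t + 1)"
  shows "gossip_bound d l k \<le>
    (d + a\<^sup>2 * (ln (real k + 3 / 2) + ln 2)) / (2 * a * (sqrt (real k + 2) - 1))"
proof -
  have "step_sq_sum l k = a\<^sup>2 * (\<Sum>t=0..k. 1 / (real t + 1))"
    unfolding step_sq_sum_def sum_distrib_left
    by (intro sum.cong) (auto simp: assms(3) power_divide)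
  then have \<beta>: "step_sq_sum l k \<le> a\<^sup>2 * (ln (real k + 3 / 2) + ln 2)"
    using harmonic_sum_le[of k] by (simp add: mult_left_mono)
  have "step_sum l k = a * (\<Sum>t=0..k. 1 / sqrt (real t + 1))"
    unfolding step_sum_def sum_distrib_left by (intro sum.cong) (auto simp: assms(3))
  then have \<alpha>: "2 * a * (sqrt (real k + 2) - 1) \<le> step_sum l k"
    using sum_inverse_sqrt_ge[of k] \<open>0 < a\<close> by (simp add: mult.assoc mult.left_commute)
  have "0 < sqrt (real k + 2) - 1" by simp
  then have pos: "0 < 2 * a * (sqrt (real k + 2) - 1)" using \<open>0 < a\<close> by simp
  have "0 \<le> step_sq_sum l k" by (simp add: step_sq_sum_def sum_nonneg)
  then show ?thesis
    unfolding gossip_bound_def add_divide_distrib[symmetric]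
    using \<alpha> \<beta> pos \<open>0 \<le> d\<close> by (intro frac_le) auto
qed

lemma inverse_sqrt_bound_bigo:
  fixes a d :: real
  assumes "0 < a"
  shows "(\<lambda>k::nat. (d + a\<^sup>2 * (ln (real k + 3 / 2) + ln 2)) / (2 * a * (sqrt (real k + 2) - 1)))
    \<in> O(\<lambda>k. ln (real k) / sqrt (real k))"
  using assms by real_asymp

section \<open>Convergence of private gossip with binary oracle\<close>

theorem theorem6:
  fixes E :: "'n::finite set set"
    and ends :: "'e::finite \<Rightarrow> 'n \<times> 'n"
    and c :: "real^'n"
    and ystar :: "real^'e"
    and lam :: "nat \<Rightarrow> real"
    and M :: "'w measure"
    and edge :: "nat \<Rightarrow> 'w \<Rightarrow> 'e"
  defines "D \<equiv> dual_objective (incidence_matrix ends) c"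
    and "EL \<equiv> \<lambda>t. prob_space.expectation M
                 (\<lambda>w. edge_loss ends (gossip_x ends lam c (\<lambda>s. edge s w) t))"
  defines "U \<equiv> gossip_bound (D ystar - D 0)"
  assumes "undirected_graph E" and "connected_graph E" and "edge_enumeration E ends"
    and "\<forall>y. D y \<le> D ystar"
    and "\<forall>t. 0 < lam t"
    and "prob_space M"
    and "prob_space.indep_vars M (\<lambda>_. count_space UNIV) edge UNIV"
    and "\<forall>t. distr M (count_space UNIV) (edge t) = uniform_count_measure UNIV"
  shows
    "(\<forall>k\<ge>1. Min (EL ` {0..k}) \<le> (\<Sum>t=0..k. lam t / step_sum lam k * EL t) \<and>
            (\<Sum>t=0..k. lam t / step_sum lam k * EL t) \<le> U lam k) \<and>
     ((\<forall>t. lam t = lam 0) \<longrightarrow>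
        (\<forall>k\<ge>1. U lam k = (D ystar - D 0) / (lam 0 * (real k + 1)) + lam 0)) \<and>
     (\<forall>R k. D ystar - D 0 \<le> R \<and> 0 < R \<and> 1 \<le> k \<longrightarrow>
        (\<forall>l. (\<forall>t\<le>k. 0 < l t) \<longrightarrow> U l k \<le> gossip_bound R l k) \<and>
        (\<forall>l. is_arg_min (\<lambda>l. gossip_bound R l k) (\<lambda>l. \<forall>t\<le>k. 0 < l t) l \<longleftrightarrow>
             (\<forall>t\<le>k. l t = sqrt (R / (real k + 1)))) \<and>
        (\<forall>l. (\<forall>t\<le>k. l t = sqrt (R / (real k + 1))) \<longrightarrow>
             gossip_bound R l k = 2 * sqrt (R / (real k + 1)))) \<and>
     (\<forall>a>0. (\<forall>k\<ge>1. (\<forall>t\<le>k. lam t = a / sqrt (real t + 1)) \<longrightarrow>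
               U lam k \<le>
                 (D ystar - D 0 + a\<^sup>2 * (ln (real k + 3 / 2) + ln 2))
                   / (2 * a * (sqrt (real k + 2) - 1))) \<and>
            (\<lambda>k::nat. (D ystar - D 0 + a\<^sup>2 * (ln (real k + 3 / 2) + ln 2))
                   / (2 * a * (sqrt (real k + 2) - 1)))
              \<in> O(\<lambda>k. ln (real k) / sqrt (real k)))"
proof -
  interpret prob_space M by fact
  \<comment> \<open>Edges are two-element sets; without loops every row of the incidence matrix has squared norm 2.\<close>
  have loopfree: "fst (ends e) \<noteq> snd (ends e)" for e
  proof -
    have "{fst (ends e), snd (ends e)} \<in> E"
      using \<open>edge_enumeration E ends\<close> unfolding edge_enumeration_def by (metis bij_betwE UNIV_I)
    then have "card {fst (ends e), snd (ends e)} = 2"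
      using \<open>undirected_graph E\<close> by (simp add: undirected_graph_def)
    then show ?thesis by (metis card_2_iff doubleton_eq_iff insert_absorb2 singleton_insert_inj_eq)
  qed
  let ?d = "D ystar - D 0"
  have gap: "0 \<le> ?d" using \<open>\<forall>y. D y \<le> D ystar\<close> by simp
  have lam: "0 < lam t" for t using \<open>\<forall>t. 0 < lam t\<close> by simp
  have loss: "(\<Sum>t=0..k. lam t * EL t) \<le> ?d + step_sq_sum lam k" for k
    unfolding EL_def
    by (rule weighted_expected_loss_le[OF loopfree]) (use assms in \<open>auto simp: D_def\<close>)
  have "Min (EL ` {0..k}) \<le> (\<Sum>t=0..k. lam t / step_sum lam k * EL t)" for k
    by (rule Min_le_weighted_average) (rule lam)
  moreover have "(\<Sum>t=0..k. lam t / step_sum lam k * EL t) \<le> U lam k" for k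
  proof -
    have "(\<Sum>t=0..k. lam t / step_sum lam k * EL t) = (\<Sum>t=0..k. lam t * EL t) / step_sum lam k"
      by (simp add: sum_divide_distrib)
    also have "\<dots> \<le> (?d + step_sq_sum lam k) / step_sum lam k"
      using loss step_sum_pos[of k lam, OF lam] by (intro divide_right_mono) auto
    finally show ?thesis by (simp add: U_def gossip_bound_def add_divide_distrib)
  qed
  moreover have "U lam k = ?d / (lam 0 * (real k + 1)) + lam 0" if "\<forall>t. lam t = lam 0" for k
    unfolding U_def using that lam by (intro gossip_bound_constant) auto
  moreover have "(\<forall>l. (\<forall>t\<le>k. 0 < l t) \<longrightarrow> U l k \<le> gossip_bound R l k) \<and>
      (\<forall>l. is_arg_min (\<lambda>l. gossip_bound R l k) (\<lambda>l. \<forall>t\<le>k. 0 < l t) l \<longleftrightarrow>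
           (\<forall>t\<le>k. l t = sqrt (R / (real k + 1)))) \<and>
      (\<forall>l. (\<forall>t\<le>k. l t = sqrt (R / (real k + 1))) \<longrightarrow>
           gossip_bound R l k = 2 * sqrt (R / (real k + 1)))"
    if R: "?d \<le> R" "0 < R" for R k
  proof (intro conjI allI impI)
    let ?r = "sqrt (R / (real k + 1))"
    have r: "0 < ?r" "R = (real k + 1) * ?r\<^sup>2" using R by auto
    show "U l k \<le> gossip_bound R l k" if "\<forall>t\<le>k. 0 < l t" for l
      using step_sum_pos[of k l] that R by (simp add: U_def gossip_bound_def divide_right_mono)
    show "is_arg_min (\<lambda>l. gossip_bound R l k) (\<lambda>l. \<forall>t\<le>k. 0 < l t) l \<longleftrightarrow> (\<forall>t\<le>k. l t = ?r)" for l
      using r by (rule gossip_bound_arg_min_iff)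
    show "gossip_bound R l k = 2 * ?r" if "\<forall>t\<le>k. l t = ?r" for l
      using gossip_bound_excess[of k l, OF _ r(2)] that r(1) by simp
  qed
  moreover have "U lam k \<le> (?d + a\<^sup>2 * (ln (real k + 3 / 2) + ln 2)) / (2 * a * (sqrt (real k + 2) - 1))"
    if "0 < a" "\<forall>t\<le>k. lam t = a / sqrt (real t + 1)" for a k
    unfolding U_def using gap that by (intro gossip_bound_inverse_sqrt) auto
  moreover note inverse_sqrt_bound_bigo
  ultimately show ?thesis by blast
qed

end
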